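(* Let $D,n\ge 3$ be integers, let $x$ be a vertex of the Hamming graph $H(D,n)$, and let $A$ be the adjacency matrix of the full bipartite graph $H(D,n)_f(x)$ of $H(D,n)$ with respect to $x$. Let $A^*$ be the diagonal matrix, indexed by the vertices of $H(D,n)$, with $(A^* )_{yy}=D(n-1)-n\,\partial(x,y)$ for every vertex $y$. Then $$A^3A^*-A^*A^3+3\,(AA^*A^2-A^2A^*A)=4(n-1)(AA^*-A^*A).$$
   Context: Hamming graph: let $S$ be a set with $n$ elements. $H(D,n)$ has vertex set $X=S^D$, and two vertices are adjacent iff they differ in precisely one coordinate. $\partial$ denotes path-length distance in $H(D,n)$ (the Hamming distance). Full bipartite graph: given a connected graph with vertex set $X$, edge set $\mathcal{E}$, distance $\partial$, and a vertex $x$, its full bipartite graph with respect to $x$ is the graph $(X,\mathcal{E}_f)$ with $\mathcal{E}_f=\mathcal{E}\setminus\{yz \mid \partial(x,y)=\partial(x,z)\}$. (Distances from $x$ are the same in both graphs.) The adjacency matrix is the usual real $0/1$ matrix with rows and columns indexed by $X$. *)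

theory Defs
  imports "HOL-Analysis.Analysis"
begin

text \<open>
  A simple graph on the type \<open>'v\<close> is given by its set of edges, an irreflexive and symmetric
  relation: the edge \<open>yz\<close> contributes both \<open>(y, z)\<close> and \<open>(z, y)\<close>.
\<close>

text \<open>
  Path-length distance: \<open>E ^^ k\<close> relates the endpoints of the walks of length \<open>k\<close>, and a shortest
  walk is a path.  The value is unspecified if \<open>y\<close> and \<open>z\<close> are not connected.
\<close>
definition graph_dist :: "('v \<times> 'v) set \<Rightarrow> 'v \<Rightarrow> 'v \<Rightarrow> nat" where
  "graph_dist E y z = (LEAST k. (y, z) \<in> E ^^ k)"

definition full_bipartite_graph :: "('v \<times> 'v) set \<Rightarrow> 'v \<Rightarrow> ('v \<times> 'v) set" where
  "full_bipartite_graph E x = E - {(y, z). graph_dist E x y = graph_dist E x z}"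

definition adjacency_matrix :: "('v \<times> 'v) set \<Rightarrow> real ^ 'v ^ 'v" where
  "adjacency_matrix E = (\<chi> y z. if (y, z) \<in> E then 1 else 0)"

text \<open>
  The Hamming graph \<open>H(D, n)\<close> with \<open>D = CARD('d)\<close> and \<open>n = CARD('s)\<close>: the set \<open>S\<close> is the
  type \<open>'s\<close>, and the vertex set \<open>S\<^sup>D\<close> is the type \<open>'s ^ 'd\<close>.
\<close>
definition hamming_graph :: "(('s ^ 'd) \<times> ('s ^ 'd)) set" where
  "hamming_graph = {(y, z). \<exists>!i. y $ i \<noteq> z $ i}"

text \<open>
  The diagonal matrix \<open>A\<^sup>*\<close>.  The subtraction \<open>n - 1\<close> is that of the reals.
\<close>
definition hamming_dual_adjacency_matrix ::
    "'s::finite ^ 'd::finite \<Rightarrow> real ^ ('s ^ 'd) ^ ('s ^ 'd)" where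
  "hamming_dual_adjacency_matrix x =
     (\<chi> y z. if y = z
             then real CARD('d) * (real CARD('s) - 1)
                  - real CARD('s) * real (graph_dist hamming_graph x y)
             else 0)"

text \<open>
  The Hamming graph is connected and its path-length distance is the Hamming distance.
\<close>
lemma hamming_graph_relpow_le:
  fixes y z :: "'s ^ 'd::finite"
  assumes "(y, z) \<in> hamming_graph ^^ k"
  shows "card {i. y $ i \<noteq> z $ i} \<le> k"
  using assms
proof (induction k arbitrary: z)
  case 0
  then show ?case by simp
next
  case (Suc k)
  then obtain w where w: "(y, w) \<in> hamming_graph ^^ k" "(w, z) \<in> hamming_graph"
    by auto
  then obtain j where j: "\<And>i. w $ i \<noteq> z $ i \<Longrightarrow> i = j"
    by (auto simp: hamming_graph_def)
  have "{i. y $ i \<noteq> z $ i} \<subseteq> insert j {i. y $ i \<noteq> w $ i}"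
    using j by fastforce
  then have "card {i. y $ i \<noteq> z $ i} \<le> card (insert j {i. y $ i \<noteq> w $ i})"
    by (intro card_mono) auto
  also have "\<dots> \<le> Suc (card {i. y $ i \<noteq> w $ i})"
    by (rule card_insert_le_m1) auto
  finally show ?case using Suc.IH[OF w(1)] by simp
qed

lemma hamming_graph_relpow_card:
  fixes y z :: "'s ^ 'd::finite"
  assumes "card {i. y $ i \<noteq> z $ i} = k"
  shows "(y, z) \<in> hamming_graph ^^ k"
  using assms
proof (induction k arbitrary: z)
  case 0
  then show ?case by (simp add: vec_eq_iff)
next
  case (Suc k)
  then obtain j where j: "y $ j \<noteq> z $ j"
    by (metis (mono_tags, lifting) card.empty empty_Collect_eq nat.distinct(1))
  define w where "w = (\<chi> i. if i = j then y $ j else z $ i)"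
  have "{i. y $ i \<noteq> w $ i} = {i. y $ i \<noteq> z $ i} - {j}"
    by (auto simp: w_def)
  then have "card {i. y $ i \<noteq> w $ i} = k"
    using Suc.prems j by simp
  then have "(y, w) \<in> hamming_graph ^^ k" by (rule Suc.IH)
  moreover have "(w, z) \<in> hamming_graph"
    using j by (auto simp: hamming_graph_def w_def)
  ultimately show ?case by auto
qed

lemma graph_dist_hamming_graph:
  fixes y z :: "'s ^ 'd::finite"
  shows "graph_dist hamming_graph y z = card {i. y $ i \<noteq> z $ i}"
  unfolding graph_dist_def
  by (rule Least_equality) (auto intro: hamming_graph_relpow_card hamming_graph_relpow_le)

end

theory Submission
  imports Defs
begin

text \<open>
  The left-hand side is the iterated commutator \<open>[A, [A, [A, A\<^sup>*]]]\<close>, so the claim is the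
  Dolan--Grady relation \<open>[A, [A, [A, A\<^sup>*]]] = 4 (n - 1) [A, A\<^sup>*]\<close>.  Being expressed by
  commutators alone, it can be checked one coordinate at a time.

  Crossing an edge of the full bipartite graph changes a single coordinate \<open>i\<close>, and moves it either
  away from \<open>x\<^sub>i\<close> or back to \<open>x\<^sub>i\<close>.  Hence \<open>A\<close> is a sum over \<open>i\<close> of matrices acting on
  coordinate \<open>i\<close> only, namely as the adjacency matrix \<open>a\<close> of the star on \<open>S\<close> with centre \<open>x\<^sub>i\<close>.
  Likewise the Hamming distance is a sum over the coordinates, so \<open>A\<^sup>*\<close> is the sum of the diagonal
  matrices \<open>b\<close> with entry \<open>n - 1\<close> at \<open>x\<^sub>i\<close> and \<open>-1\<close> elsewhere
  (\<open>adjacency_matrix_eq_coordinate_sum\<close>, \<open>dual_adjacency_matrix_eq_coordinate_sum\<close>).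
  Matrices acting on different coordinates commute, so such sums are closed under commutators, which
  are formed coordinatewise (\<open>commutator_coordinate_sum\<close>).  This leaves the case of the star:
  there \<open>a\<^sup>2\<close> commutes with \<open>b\<close> and \<open>a\<^sup>3 = (n - 1) a\<close>, which forces the relation
  (\<open>dolan_grady_if_square_commutes\<close>).
\<close>

section \<open>Commutators of matrices\<close>

definition commutator :: "real ^ 'v ^ 'v \<Rightarrow> real ^ 'v ^ 'v \<Rightarrow> real ^ 'v ^ 'v" where
  "commutator M N = M ** N - N ** M"

lemma matrix_diff_ldistrib:
  fixes M :: "real ^ 'k::finite ^ 'm" and N P :: "real ^ 'l ^ 'k"
  shows "M ** (N - P) = M ** N - M ** P"
  by (simp add: matrix_matrix_mult_def vec_eq_iff right_diff_distrib sum_subtractf)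

lemma matrix_diff_rdistrib:
  fixes M N :: "real ^ 'k::finite ^ 'm" and P :: "real ^ 'l ^ 'k"
  shows "(M - N) ** P = M ** P - N ** P"
  by (simp add: matrix_matrix_mult_def vec_eq_iff left_diff_distrib sum_subtractf)

lemma matrix_mult_sum_left:
  fixes f :: "'i \<Rightarrow> real ^ 'k::finite ^ 'm" and N :: "real ^ 'l ^ 'k"
  shows "(\<Sum>i\<in>I. f i) ** N = (\<Sum>i\<in>I. f i ** N)"
  by (simp add: matrix_matrix_mult_def vec_eq_iff sum_distrib_right sum.swap[of _ I])

lemma matrix_mult_sum_right:
  fixes f :: "'i \<Rightarrow> real ^ 'l ^ 'k::finite" and M :: "real ^ 'k ^ 'm"
  shows "M ** (\<Sum>i\<in>I. f i) = (\<Sum>i\<in>I. M ** f i)"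
  by (simp add: matrix_matrix_mult_def vec_eq_iff sum_distrib_left sum.swap[of _ I])

lemma commutator_sum:
  fixes f :: "'i \<Rightarrow> real ^ 'v ^ 'v::finite"
  shows "commutator (\<Sum>i\<in>I. f i) (\<Sum>j\<in>J. g j) = (\<Sum>i\<in>I. \<Sum>j\<in>J. commutator (f i) (g j))"
proof -
  have "(\<Sum>i\<in>I. f i) ** (\<Sum>j\<in>J. g j) = (\<Sum>i\<in>I. \<Sum>j\<in>J. f i ** g j)"
    unfolding matrix_mult_sum_left matrix_mult_sum_right by (rule sum.swap)
  moreover have "(\<Sum>j\<in>J. g j) ** (\<Sum>i\<in>I. f i) = (\<Sum>i\<in>I. \<Sum>j\<in>J. g j ** f i)"
    unfolding matrix_mult_sum_left matrix_mult_sum_right ..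
  ultimately show ?thesis
    by (simp add: commutator_def sum_subtractf)
qed

lemma triple_commutator_expand:
  fixes M N :: "real ^ 'v ^ 'v::finite"
  shows "commutator M (commutator M (commutator M N)) =
    (M ** M ** M) ** N - N ** (M ** M ** M) + 3 *\<^sub>R (M ** N ** (M ** M) - (M ** M) ** N ** M)"
proof -
  have three: "3 *\<^sub>R P = P + P + P" for P :: "real ^ 'v ^ 'v"
    by (simp add: vec_eq_iff)
  show ?thesis
    unfolding commutator_def matrix_diff_ldistrib matrix_diff_rdistrib matrix_mul_assoc three
    by (simp add: algebra_simps)
qed

text \<open>
  When \<open>M\<^sup>2\<close> commutes with \<open>N\<close>, both \<open>M N M\<^sup>2\<close> and \<open>M\<^sup>2 N M\<close> turn into \<open>M\<^sup>3 N\<close> and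
  \<open>N M\<^sup>3\<close> respectively, so the triple commutator is \<open>(1 + 3) [M\<^sup>3, N]\<close>.
\<close>
lemma dolan_grady_if_square_commutes:
  fixes M N :: "real ^ 'v ^ 'v::finite"
  assumes square: "(M ** M) ** N = N ** (M ** M)"
    and cube: "M ** M ** M = c *\<^sub>R M"
  shows "commutator M (commutator M (commutator M N)) = (4 * c) *\<^sub>R commutator M N"
proof -
  have "M ** N ** (M ** M) = M ** (M ** M) ** N"
    by (metis square matrix_mul_assoc)
  then have left: "M ** N ** (M ** M) = c *\<^sub>R (M ** N)"
    by (simp add: matrix_mul_assoc cube scalar_matrix_assoc)
  have "(M ** M) ** N ** M = N ** (M ** M ** M)"
    by (simp add: square matrix_mul_assoc)
  then have right: "(M ** M) ** N ** M = c *\<^sub>R (N ** M)"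
    by (simp add: cube matrix_scalar_ac scalar_matrix_assoc)
  have four: "c *\<^sub>R P + 3 *\<^sub>R (c *\<^sub>R P) = (4 * c) *\<^sub>R P" for P :: "real ^ 'v ^ 'v"
    by (simp add: vec_eq_iff)
  have "(c *\<^sub>R M) ** N - N ** (c *\<^sub>R M) = c *\<^sub>R commutator M N"
    by (simp add: commutator_def scalar_matrix_assoc[symmetric] matrix_scalar_ac scaleR_diff_right)
  then show ?thesis
    unfolding triple_commutator_expand left right cube
    by (simp only: scaleR_diff_right[symmetric] commutator_def[symmetric] four)
qed

section \<open>Matrices acting on one coordinate\<close>

text \<open>
  Viewing the functions on \<open>S\<^sup>D\<close> as the tensor power of the functions on \<open>S\<close>, this is \<open>m\<close> in the
  tensor factor \<open>i\<close> and the identity in all the others.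
\<close>
definition coordinate_matrix ::
    "'d::finite \<Rightarrow> real ^ 's ^ 's \<Rightarrow> real ^ ('s::finite ^ 'd) ^ ('s ^ 'd)" where
  "coordinate_matrix i m =
     (\<chi> y z. if \<forall>j. j \<noteq> i \<longrightarrow> y $ j = z $ j then m $ (y $ i) $ (z $ i) else 0)"

definition replace_coordinate :: "'s ^ 'd::finite \<Rightarrow> 'd \<Rightarrow> 's \<Rightarrow> 's ^ 'd" where
  "replace_coordinate y i s = (\<chi> j. if j = i then s else y $ j)"

lemma replace_coordinate_nth [simp]:
  "replace_coordinate y i s $ j = (if j = i then s else y $ j)"
  by (simp add: replace_coordinate_def)

lemma coordinate_matrix_mult_nth:
  fixes y z :: "'s::finite ^ 'd::finite"
  shows "(coordinate_matrix i m ** N) $ y $ z =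
    (\<Sum>s\<in>UNIV. m $ (y $ i) $ s * N $ replace_coordinate y i s $ z)"
proof -
  let ?agree = "{v. \<forall>j. j \<noteq> i \<longrightarrow> y $ j = v $ j}"
  have inj: "inj (replace_coordinate y i)"
    by (rule injI) (metis replace_coordinate_nth)
  have range: "?agree = range (replace_coordinate y i)"
  proof
    show "?agree \<subseteq> range (replace_coordinate y i)"
    proof
      fix v assume "v \<in> ?agree"
      then have "v = replace_coordinate y i (v $ i)"
        by (simp add: vec_eq_iff)
      then show "v \<in> range (replace_coordinate y i)" by blast
    qed
  qed auto
  have "(coordinate_matrix i m ** N) $ y $ z =
      (\<Sum>v\<in>UNIV. if v \<in> ?agree then m $ (y $ i) $ (v $ i) * N $ v $ z else 0)"
    by (auto simp: matrix_matrix_mult_def coordinate_matrix_def intro!: sum.cong)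
  also have "\<dots> = (\<Sum>v\<in>?agree. m $ (y $ i) $ (v $ i) * N $ v $ z)"
    by (simp flip: sum.inter_filter)
  also have "\<dots> = (\<Sum>s\<in>UNIV. m $ (y $ i) $ s * N $ replace_coordinate y i s $ z)"
    unfolding range using inj by (simp add: sum.reindex)
  finally show ?thesis .
qed

lemma coordinate_matrix_mult_same:
  fixes i :: "'d::finite" and m m' :: "real ^ 's ^ 's::finite"
  shows "coordinate_matrix i m ** coordinate_matrix i m' = coordinate_matrix i (m ** m')"
proof (intro iffD2[OF vec_eq_iff] allI)
  fix y z :: "'s ^ 'd"
  have "(coordinate_matrix i m ** coordinate_matrix i m') $ y $ z =
      (\<Sum>s\<in>UNIV. m $ (y $ i) $ s * (if \<forall>j. j \<noteq> i \<longrightarrow> y $ j = z $ j then m' $ s $ (z $ i) else 0))"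
    unfolding coordinate_matrix_mult_nth
    by (intro sum.cong) (auto simp: coordinate_matrix_def)
  also have "\<dots> = coordinate_matrix i (m ** m') $ y $ z"
    by (auto simp: coordinate_matrix_def matrix_matrix_mult_def intro!: sum.neutral)
  finally show "(coordinate_matrix i m ** coordinate_matrix i m') $ y $ z =
      coordinate_matrix i (m ** m') $ y $ z" .
qed

text \<open>
  A walk from \<open>y\<close> to \<open>z\<close> that changes coordinate \<open>i\<close> first and coordinate \<open>j\<close> second must pass
  through \<open>y\<close> with its coordinate \<open>i\<close> replaced by that of \<open>z\<close>; the resulting product is symmetric
  under exchange of the two coordinates.
\<close>
lemma coordinate_matrix_mult_different_nth:
  fixes y z :: "'s::finite ^ 'd::finite"
  assumes "i \<noteq> j"
  shows "(coordinate_matrix i m ** coordinate_matrix j m') $ y $ z =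
    (if \<forall>k. k \<noteq> i \<and> k \<noteq> j \<longrightarrow> y $ k = z $ k
     then m $ (y $ i) $ (z $ i) * m' $ (y $ j) $ (z $ j) else 0)"
proof -
  have "(coordinate_matrix i m ** coordinate_matrix j m') $ y $ z =
      (\<Sum>s\<in>UNIV. if s = z $ i
        then (if \<forall>k. k \<noteq> i \<and> k \<noteq> j \<longrightarrow> y $ k = z $ k
              then m $ (y $ i) $ (z $ i) * m' $ (y $ j) $ (z $ j) else 0) else 0)"
    unfolding coordinate_matrix_mult_nth
    using assms by (intro sum.cong) (auto simp: coordinate_matrix_def)
  then show ?thesis by simp
qed

lemma commutator_coordinate_matrix:
  "commutator (coordinate_matrix i m) (coordinate_matrix j m') =
    (if i = j then coordinate_matrix i (commutator m m') else 0)"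
proof (cases "i = j")
  case True
  then show ?thesis
    by (simp add: commutator_def coordinate_matrix_mult_same)
      (auto simp: coordinate_matrix_def vec_eq_iff)
next
  case False
  then show ?thesis
    by (auto simp: commutator_def vec_eq_iff coordinate_matrix_mult_different_nth)
qed

definition coordinate_sum ::
    "('d::finite \<Rightarrow> real ^ 's ^ 's) \<Rightarrow> real ^ ('s::finite ^ 'd) ^ ('s ^ 'd)" where
  "coordinate_sum m = (\<Sum>i\<in>UNIV. coordinate_matrix i (m i))"

lemma coordinate_sum_nth:
  "coordinate_sum m $ y $ z =
    (\<Sum>i\<in>UNIV. if \<forall>j. j \<noteq> i \<longrightarrow> y $ j = z $ j then m i $ (y $ i) $ (z $ i) else 0)"
  by (simp add: coordinate_sum_def coordinate_matrix_def)

lemma coordinate_sum_scaleR: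
  "coordinate_sum (\<lambda>i. c *\<^sub>R m i) = c *\<^sub>R coordinate_sum m"
  by (auto simp: vec_eq_iff coordinate_sum_nth sum_distrib_left intro!: sum.cong)

text \<open>
  All cross terms vanish, as matrices acting on different coordinates commute.  There is no such rule
  for products, which is why the relation is written in terms of commutators.
\<close>
lemma commutator_coordinate_sum:
  "commutator (coordinate_sum m) (coordinate_sum m') =
    coordinate_sum (\<lambda>i. commutator (m i) (m' i))"
  by (simp add: coordinate_sum_def commutator_sum commutator_coordinate_matrix)

section \<open>The star\<close>

text \<open>
  These two matrices are \<open>A\<close> and \<open>A\<^sup>*\<close> for the complete graph \<open>H(1, n)\<close> and its vertex \<open>p\<close>.
\<close>
definition star_matrix :: "'s \<Rightarrow> real ^ 's::finite ^ 's" where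
  "star_matrix p = (\<chi> s t. if (s = p) \<noteq> (t = p) then 1 else 0)"

definition star_dual_matrix :: "'s \<Rightarrow> real ^ 's::finite ^ 's" where
  "star_dual_matrix p = (\<chi> s t. if s = t then (if s = p then real CARD('s) else 0) - 1 else 0)"

lemma star_matrix_square_nth:
  fixes p :: "'s::finite"
  shows "(star_matrix p ** star_matrix p) $ s $ t =
    (if s = p \<and> t = p then real CARD('s) - 1 else if s \<noteq> p \<and> t \<noteq> p then 1 else 0)"
proof -
  have "(star_matrix p ** star_matrix p) $ s $ t =
      (\<Sum>v\<in>UNIV. if s = p \<and> t = p then 1 - (if v = p then 1 else 0)
        else if s \<noteq> p \<and> t \<noteq> p then (if v = p then 1 else 0) else 0)"
    by (auto simp: matrix_matrix_mult_def star_matrix_def intro!: sum.cong)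
  then show ?thesis by (auto simp: sum_subtractf)
qed

lemma star_matrix_cube:
  fixes p :: "'s::finite"
  shows "star_matrix p ** star_matrix p ** star_matrix p = (real CARD('s) - 1) *\<^sub>R star_matrix p"
proof (intro iffD2[OF vec_eq_iff] allI)
  fix s t
  let ?n = "real CARD('s)"
  have "(star_matrix p ** star_matrix p ** star_matrix p) $ s $ t =
      (\<Sum>v\<in>UNIV. (star_matrix p ** star_matrix p) $ s $ v * star_matrix p $ v $ t)"
    by (simp add: matrix_matrix_mult_def[of "star_matrix p ** star_matrix p"])
  also have "\<dots> = (\<Sum>v\<in>UNIV. if s = p \<and> t \<noteq> p then (if v = p then ?n - 1 else 0)
        else if s \<noteq> p \<and> t = p then 1 - (if v = p then 1 else 0) else 0)"
    unfolding star_matrix_square_nth by (intro sum.cong) (auto simp: star_matrix_def)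
  also have "\<dots> = ((?n - 1) *\<^sub>R star_matrix p) $ s $ t"
    by (auto simp: sum_subtractf star_matrix_def)
  finally show "(star_matrix p ** star_matrix p ** star_matrix p) $ s $ t =
      ((?n - 1) *\<^sub>R star_matrix p) $ s $ t" .
qed

text \<open>
  Two steps in the star lead from the centre to the centre and from the leaves to the leaves, and on
  each of these two sets the diagonal matrix is constant.
\<close>
lemma star_matrix_square_commutes:
  "(star_matrix p ** star_matrix p) ** star_dual_matrix p =
    star_dual_matrix p ** (star_matrix p ** star_matrix p)"
proof (intro iffD2[OF vec_eq_iff] allI)
  fix s t
  let ?Q = "star_matrix p ** star_matrix p" and ?b = "star_dual_matrix p"
  have "(?Q ** ?b) $ s $ t = (\<Sum>v\<in>UNIV. if v = t then ?Q $ s $ t * ?b $ t $ t else 0)"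
    unfolding matrix_matrix_mult_def[of ?Q]
    by (subst vec_lambda_beta, subst vec_lambda_beta, intro sum.cong) (auto simp: star_dual_matrix_def)
  also have "\<dots> = ?b $ s $ s * ?Q $ s $ t"
    by (auto simp: star_matrix_square_nth star_dual_matrix_def)
  also have "\<dots> = (\<Sum>v\<in>UNIV. if v = s then ?b $ s $ s * ?Q $ s $ t else 0)"
    by simp
  also have "\<dots> = (?b ** ?Q) $ s $ t"
    unfolding matrix_matrix_mult_def[of ?b]
    by (subst vec_lambda_beta, subst vec_lambda_beta, intro sum.cong) (auto simp: star_dual_matrix_def)
  finally show "(?Q ** ?b) $ s $ t = (?b ** ?Q) $ s $ t" .
qed

section \<open>The full bipartite graph of the Hamming graph\<close>

lemma card_diff_coordinates_eq_iff:
  fixes x y z :: "'s ^ 'd::finite"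
  assumes agree: "\<And>j. j \<noteq> i \<Longrightarrow> y $ j = z $ j"
  shows "card {j. x $ j \<noteq> y $ j} = card {j. x $ j \<noteq> z $ j} \<longleftrightarrow> (y $ i = x $ i \<longleftrightarrow> z $ i = x $ i)"
proof -
  let ?C = "{j. j \<noteq> i \<and> x $ j \<noteq> y $ j}"
  have "{j. x $ j \<noteq> y $ j} = (if y $ i = x $ i then ?C else insert i ?C)"
    by auto
  moreover have "{j. x $ j \<noteq> z $ j} = (if z $ i = x $ i then ?C else insert i ?C)"
    using agree by auto metis+
  ultimately show ?thesis by simp
qed

text \<open>
  For vertices adjacent in the Hamming graph, only the coordinate in which they differ contributes
  to the sum, and their distances from \<open>x\<close> differ precisely if exactly one of them agrees with \<open>x\<close>
  there.
\<close>
lemma adjacency_matrix_eq_coordinate_sum: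
  fixes x :: "'s::finite ^ 'd::finite"
  shows "adjacency_matrix (full_bipartite_graph hamming_graph x) =
    coordinate_sum (\<lambda>i. star_matrix (x $ i))"
proof (intro iffD2[OF vec_eq_iff] allI)
  fix y z :: "'s ^ 'd"
  let ?term = "\<lambda>i. if \<forall>j. j \<noteq> i \<longrightarrow> y $ j = z $ j then star_matrix (x $ i) $ (y $ i) $ (z $ i) else 0"
  show "adjacency_matrix (full_bipartite_graph hamming_graph x) $ y $ z =
      coordinate_sum (\<lambda>i. star_matrix (x $ i)) $ y $ z"
  proof (cases "(y, z) \<in> hamming_graph")
    case True
    then obtain i where i: "y $ i \<noteq> z $ i" and agree: "\<And>j. j \<noteq> i \<Longrightarrow> y $ j = z $ j"
      by (auto simp: hamming_graph_def)
    have "coordinate_sum (\<lambda>i. star_matrix (x $ i)) $ y $ z =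
        (\<Sum>k\<in>UNIV. if k = i then star_matrix (x $ i) $ (y $ i) $ (z $ i) else 0)"
      unfolding coordinate_sum_nth using i agree by (intro sum.cong) auto
    then have "coordinate_sum (\<lambda>i. star_matrix (x $ i)) $ y $ z =
        (if (y $ i = x $ i) \<noteq> (z $ i = x $ i) then 1 else 0)"
      by (simp add: star_matrix_def)
    moreover have "(y, z) \<in> full_bipartite_graph hamming_graph x \<longleftrightarrow>
        (y $ i = x $ i) \<noteq> (z $ i = x $ i)"
      using True card_diff_coordinates_eq_iff[of i y z x, OF agree]
      by (simp add: full_bipartite_graph_def graph_dist_hamming_graph)
    ultimately show ?thesis
      by (simp add: adjacency_matrix_def)
  next
    case False
    have "y $ k = z $ k" if "\<forall>j. j \<noteq> k \<longrightarrow> y $ j = z $ j" for k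
      using False that by (simp add: hamming_graph_def) metis
    then have "?term k = 0" for k
      by (simp add: star_matrix_def)
    then have "(\<Sum>k\<in>UNIV. ?term k) = 0"
      by (intro sum.neutral) blast
    then show ?thesis
      using False by (simp add: coordinate_sum_nth adjacency_matrix_def full_bipartite_graph_def)
  qed
qed

lemma dual_adjacency_matrix_eq_coordinate_sum:
  fixes x :: "'s::finite ^ 'd::finite"
  shows "hamming_dual_adjacency_matrix x = coordinate_sum (\<lambda>i. star_dual_matrix (x $ i))"
proof (intro iffD2[OF vec_eq_iff] allI)
  fix y z :: "'s ^ 'd"
  show "hamming_dual_adjacency_matrix x $ y $ z =
      coordinate_sum (\<lambda>i. star_dual_matrix (x $ i)) $ y $ z"
  proof (cases "y = z")
    case True
    let ?n = "real CARD('s)" and ?N = "{i. x $ i \<noteq> y $ i}"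
    have "coordinate_sum (\<lambda>i. star_dual_matrix (x $ i)) $ y $ y =
        (\<Sum>i\<in>UNIV. (?n - 1) - ?n * (if i \<in> ?N then 1 else 0))"
      unfolding coordinate_sum_nth by (intro sum.cong) (auto simp: star_dual_matrix_def)
    also have "\<dots> = real CARD('d) * (?n - 1) - ?n * (\<Sum>i\<in>UNIV. if i \<in> ?N then 1 else 0)"
      by (simp add: sum_subtractf sum_distrib_left)
    also have "(\<Sum>i\<in>UNIV. if i \<in> ?N then 1 else 0) = real (card ?N)"
      by (subst sum.inter_filter[symmetric]) auto
    finally show ?thesis
      using True by (simp add: hamming_dual_adjacency_matrix_def graph_dist_hamming_graph)
  next
    case False
    have "y $ i \<noteq> z $ i" if "\<forall>j. j \<noteq> i \<longrightarrow> y $ j = z $ j" for i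
      using False that by (metis vec_eq_iff)
    then have "coordinate_sum (\<lambda>i. star_dual_matrix (x $ i)) $ y $ z = 0"
      unfolding coordinate_sum_nth
      by (intro sum.neutral) (simp add: star_dual_matrix_def)
    then show ?thesis
      using False by (simp add: hamming_dual_adjacency_matrix_def)
  qed
qed

theorem theorem5p2:
  fixes D n :: nat
    and x :: "'s::finite ^ 'd::finite"
    and A A_star :: "real ^ ('s ^ 'd) ^ ('s ^ 'd)"
  assumes "D = CARD('d)" and "n = CARD('s)"
    and "D \<ge> 3" and "n \<ge> 3"
    and "A = adjacency_matrix (full_bipartite_graph hamming_graph x)"
    and "A_star = hamming_dual_adjacency_matrix x"
  shows "(A ** A ** A) ** A_star - A_star ** (A ** A ** A)
           + 3 *\<^sub>R (A ** A_star ** (A ** A) - (A ** A) ** A_star ** A)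
         = (4 * (real n - 1)) *\<^sub>R (A ** A_star - A_star ** A)"
proof -
  let ?a = "\<lambda>i. star_matrix (x $ i)" and ?b = "\<lambda>i. star_dual_matrix (x $ i)"
  have A: "A = coordinate_sum ?a" and A_star: "A_star = coordinate_sum ?b"
    using assms by (simp_all add: adjacency_matrix_eq_coordinate_sum
        dual_adjacency_matrix_eq_coordinate_sum)
  have star: "commutator (?a i) (commutator (?a i) (commutator (?a i) (?b i))) =
      (4 * (real n - 1)) *\<^sub>R commutator (?a i) (?b i)" for i
    using dolan_grady_if_square_commutes[OF star_matrix_square_commutes star_matrix_cube]
    by (simp add: assms(2))
  have "commutator A (commutator A (commutator A A_star)) =
      (4 * (real n - 1)) *\<^sub>R commutator A A_star"
    unfolding A A_star commutator_coordinate_sum star coordinate_sum_scaleR ..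
  then show ?thesis
    unfolding triple_commutator_expand by (simp add: commutator_def)
qed

end
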